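(* Let $X$ be an $n$-Hilbert space, let $a_2,\dots,a_n\in X$ be fixed, let $X_F$ be the associated Hilbert space, and let $K\in\mathcal B(X_F)$. Let $\{e_i\}_{i=1}^\infty$ be an orthonormal basis of $l^2(\mathbb N)$ and let $\{f_i\}_{i=1}^\infty$ be a sequence in $X$. Then $\{f_i\}_{i=1}^\infty$ is a $K$-frame associated to $(a_2,\dots,a_n)$ for $X$ if and only if there exists a bounded linear operator $T:l^2(\mathbb N)\to X_F$ such that $f_i=Te_i$ for all $i$ and $\mathcal R(K)\subseteq\mathcal R(T)$.
   Context: Setting. Let $n\ge 2$ and let $X$ be a linear space over $\mathbb K\in\{\mathbb R,\mathbb C\}$ of dimension at least $n$. An $n$-inner product on $X$ is a map $\langle\cdot,\cdot\,|\,\cdot,\dots,\cdot\rangle:X^{n+1}\to\mathbb K$ such that: (I) $\langle x_1,x_1|x_2,\dots,x_n\rangle\ge 0$, with equality iff $x_1,\dots,x_n$ are linearly dependent; (II) $\langle x,y|x_2,\dots,x_n\rangle$ is invariant under permutations of $x_2,\dots,x_n$; (III) $\langle x,y|x_2,\dots,x_n\rangle=\overline{\langle y,x|x_2,\dots,x_n\rangle}$; (IV),(V) it is linear in the first variable. It induces the $n$-norm $\|x_1,x_2,\dots,x_n\|=\sqrt{\langle x_1,x_1|x_2,\dots,x_n\rangle}$. A sequence $\{x_k\}$ in $X$ converges to $x$ if $\|x_k-x,x_2,\dots,x_n\|\to 0$ for all $x_2,\dots,x_n\in X$, and is Cauchy if $\|x_l-x_k,x_2,\dots,x_n\|\to0$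 as $l,k\to\infty$ for all $x_2,\dots,x_n\in X$; $X$ is an $n$-Hilbert space if every Cauchy sequence converges. Let $X$ be an $n$-Hilbert space, $a_2,\dots,a_n\in X$ fixed linearly independent vectors, $F=\{a_2,\dots,a_n\}$, and $L_F$ the span of $F$. Then $\langle x+L_F,y+L_F\rangle_F=\langle x,y|a_2,\dots,a_n\rangle$ is an inner product on $X/L_F$ (identified with an algebraic complement $M_F$ of $L_F$ in $X$), and $X_F$ denotes its Hilbert space completion. Elements of $X$ are regarded as elements of $X_F$ through the canonical map $X\to X/L_F\to X_F$ (so $f_i=Te_i$ is an equality in $X_F$). For $f,g\in X_F$ write $\langle f,g|a_2,\dots,a_n\rangle=\langle f,g\rangle_F$ and $\|f,a_2,\dots,a_n\|=\|f\|_F$ for the inner product and norm of $X_F$. $\mathcal B(X_F)$ is the space of bounded linear operators on $X_F$, $\mathcal R(\cdot)$ denotes range, and $l^2(\mathbb N)$ is the Hilbert space of square-summable $\mathbb K$-valued sequences indexed by $\mathbb N$. For $K\in\mathcal B(X_F)$, a sequence $\{f_i\}_{i=1}^\infty$ in $X$ (or in $X_F$) is a $K$-frame associated to $(a_2,\dots,a_n)$ for $X$ if there are constants $0<A\le B<\infty$ (called bounds) such that for all $f\in X_F$ $$A\|K^*f,a_2,\dots,a_n\|^2\le\sum_{i=1}^\infty|\langle f,f_i|a_2,\dots,a_n\rangle|^2\le B\|f,a_2,\dots,a_n\|^2 .$$ *)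

theory Defs
  imports "HOL-Analysis.Analysis"
begin

section \<open>The scalar field\<close>

text \<open>
  The scalars are the reals or the complex numbers: a type of this class is, by way of
  \<open>to_complex\<close>, a copy of one of these two subfields of the complex numbers, with its norm.
\<close>

class real_or_complex = real_normed_field +
  fixes to_complex :: "'a \<Rightarrow> complex"
  assumes to_complex_add: "to_complex (x + y) = to_complex x + to_complex y"
    and to_complex_mult: "to_complex (x * y) = to_complex x * to_complex y"
    and to_complex_scaleR: "to_complex (r *\<^sub>R x) = r *\<^sub>R to_complex x"
    and norm_to_complex: "norm (to_complex x) = norm x"
    and range_to_complex: "range to_complex = \<real> \<or> range to_complex = UNIV"

instantiation real :: real_or_complex
begin

definition to_complex_real :: "real \<Rightarrow> complex"
  where "to_complex_real = complex_of_real"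

instance
  by standard (auto simp: to_complex_real_def scaleR_conv_of_real Reals_def)

end

instantiation complex :: real_or_complex
begin

definition to_complex_complex :: "complex \<Rightarrow> complex"
  where "to_complex_complex z = z"

instance
  by standard (auto simp: to_complex_complex_def image_def)

end

definition scalar_cnj :: "'k::real_or_complex \<Rightarrow> 'k"
  where "scalar_cnj x = (THE y. to_complex y = cnj (to_complex x))"

definition scalar_Re :: "'k::real_or_complex \<Rightarrow> real"
  where "scalar_Re x = Re (to_complex x)"

lemma to_complex_eq_iff: "to_complex x = to_complex y \<longleftrightarrow> x = (y :: 'k::real_or_complex)"
proof
  assume eq: "to_complex x = to_complex y"
  have "to_complex (x - y) + to_complex y = to_complex x"
    by (simp flip: to_complex_add)
  with eq have "to_complex (x - y) = 0"
    by simp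
  then show "x = y"
    using norm_to_complex[of "x - y"] by simp
qed simp

lemma to_complex_scalar_cnj: "to_complex (scalar_cnj x) = cnj (to_complex (x :: 'k::real_or_complex))"
proof -
  have "cnj (to_complex x) \<in> range (to_complex :: 'k \<Rightarrow> complex)"
  proof (cases "range (to_complex :: 'k \<Rightarrow> complex) = \<real>")
    case True
    then have "to_complex x \<in> \<real>"
      by blast
    then show ?thesis
      using True by (simp add: Reals_cnj_iff)
  next
    case False
    then show ?thesis
      using range_to_complex[where 'a = 'k] by blast
  qed
  then obtain y :: 'k where y: "to_complex y = cnj (to_complex x)"
    by (metis imageE)
  have "\<exists>!y :: 'k. to_complex y = cnj (to_complex x)"
    using y by (metis to_complex_eq_iff)
  then show ?thesis
    unfolding scalar_cnj_def by (rule theI')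
qed


section \<open>Hilbert spaces over the scalar field\<close>

text \<open>
  Inner products are linear in the first argument. The condition of lying in
  \<open>\<real>\<^sub>\<ge>\<^sub>0\<close> says that the scalar is real and nonnegative.
\<close>

definition hnorm :: "('h \<Rightarrow> 'h \<Rightarrow> 'k::real_or_complex) \<Rightarrow> 'h \<Rightarrow> real"
  where "hnorm inn x = sqrt (scalar_Re (inn x x))"

locale hilbert_space = vector_space scaleH
  for scaleH :: "'k::real_or_complex \<Rightarrow> 'h::ab_group_add \<Rightarrow> 'h" +
  fixes inn :: "'h \<Rightarrow> 'h \<Rightarrow> 'k"
  assumes inn_self_nonneg: "inn x x \<in> \<real>\<^sub>\<ge>\<^sub>0"
    and inn_self_eq_0: "inn x x = 0 \<longleftrightarrow> x = 0"
    and inn_commute: "inn x y = scalar_cnj (inn y x)"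
    and inn_add_left: "inn (x + x') y = inn x y + inn x' y"
    and inn_scale_left: "inn (scaleH c x) y = c * inn x y"
    and complete:
      "((\<lambda>(l, k). hnorm inn (s l - s k)) \<longlongrightarrow> 0) (sequentially \<times>\<^sub>F sequentially) \<Longrightarrow>
        \<exists>x. (\<lambda>k. hnorm inn (s k - x)) \<longlonglongrightarrow> 0"

definition bounded_operator ::
  "('k::real_or_complex \<Rightarrow> 'g::ab_group_add \<Rightarrow> 'g) \<Rightarrow> ('g \<Rightarrow> 'g \<Rightarrow> 'k) \<Rightarrow>
   ('k \<Rightarrow> 'h::ab_group_add \<Rightarrow> 'h) \<Rightarrow> ('h \<Rightarrow> 'h \<Rightarrow> 'k) \<Rightarrow> ('g \<Rightarrow> 'h) \<Rightarrow> bool"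
  where "bounded_operator scaleG innG scaleH innH T \<longleftrightarrow>
    Vector_Spaces.linear scaleG scaleH T \<and>
    (\<exists>C. \<forall>x. hnorm innH (T x) \<le> C * hnorm innG x)"

definition hadjoint :: "('h \<Rightarrow> 'h \<Rightarrow> 'k) \<Rightarrow> ('h \<Rightarrow> 'h) \<Rightarrow> 'h \<Rightarrow> 'h"
  where "hadjoint inn K f = (THE g. \<forall>h. inn (K h) f = inn h g)"

definition hdense :: "('h::ab_group_add \<Rightarrow> 'h \<Rightarrow> 'k::real_or_complex) \<Rightarrow> 'h set \<Rightarrow> bool"
  where "hdense inn S \<longleftrightarrow> (\<forall>x. \<forall>\<epsilon>>0. \<exists>y\<in>S. hnorm inn (x - y) < \<epsilon>)"

definition orthonormal_basis ::
  "('k::real_or_complex \<Rightarrow> 'h::ab_group_add \<Rightarrow> 'h) \<Rightarrow> ('h \<Rightarrow> 'h \<Rightarrow> 'k) \<Rightarrow> (nat \<Rightarrow> 'h) \<Rightarrow> bool"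
  where "orthonormal_basis scaleH inn e \<longleftrightarrow>
    (\<forall>i j. inn (e i) (e j) = (if i = j then 1 else 0)) \<and>
    hdense inn (module.span scaleH (range e))"


section \<open>The space of square-summable sequences\<close>

typedef (overloaded) 'k l2 = "{x :: nat \<Rightarrow> 'k::real_or_complex. summable (\<lambda>i. (norm (x i))\<^sup>2)}"
  morphisms l2_nth Abs_l2
  by (rule exI[of _ "\<lambda>_. 0"]) simp

setup_lifting type_definition_l2

lemma summable_norm_square_add:
  fixes x y :: "nat \<Rightarrow> 'k::real_normed_vector"
  assumes "summable (\<lambda>i. (norm (x i))\<^sup>2)" "summable (\<lambda>i. (norm (y i))\<^sup>2)"
  shows "summable (\<lambda>i. (norm (x i + y i))\<^sup>2)"
proof (rule summable_comparison_test')
  show "summable (\<lambda>i. 2 * (norm (x i))\<^sup>2 + 2 * (norm (y i))\<^sup>2)"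
    using assms by (intro summable_add summable_mult)
  show "norm ((norm (x i + y i))\<^sup>2) \<le> 2 * (norm (x i))\<^sup>2 + 2 * (norm (y i))\<^sup>2" if "i \<ge> 0" for i
  proof -
    have "(norm (x i + y i))\<^sup>2 \<le> (norm (x i) + norm (y i))\<^sup>2"
      by (intro power_mono norm_triangle_ineq) simp
    also have "\<dots> \<le> 2 * (norm (x i))\<^sup>2 + 2 * (norm (y i))\<^sup>2"
      using sum_squares_bound[of "norm (x i)" "norm (y i)"] by (simp add: power2_sum)
    finally show ?thesis
      by simp
  qed
qed

instantiation l2 :: (real_or_complex) ab_group_add
begin

lift_definition zero_l2 :: "'a l2" is "\<lambda>_. 0"
  by simp

lift_definition plus_l2 :: "'a l2 \<Rightarrow> 'a l2 \<Rightarrow> 'a l2" is "\<lambda>x y i. x i + y i"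
  by (rule summable_norm_square_add)

lift_definition uminus_l2 :: "'a l2 \<Rightarrow> 'a l2" is "\<lambda>x i. - x i"
  by simp

lift_definition minus_l2 :: "'a l2 \<Rightarrow> 'a l2 \<Rightarrow> 'a l2" is "\<lambda>x y i. x i - y i"
  using summable_norm_square_add[of _ "\<lambda>i. - _ i"] by simp

instance
  by standard (transfer; simp add: fun_eq_iff algebra_simps)+

end

lift_definition l2_scale :: "'k::real_or_complex \<Rightarrow> 'k l2 \<Rightarrow> 'k l2" is "\<lambda>c x i. c * x i"
  by (simp add: norm_mult power_mult_distrib summable_mult)

definition l2_inn :: "'k::real_or_complex l2 \<Rightarrow> 'k l2 \<Rightarrow> 'k"
  where "l2_inn x y = (\<Sum>i. l2_nth x i * scalar_cnj (l2_nth y i))"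


section \<open>\<open>n\<close>-Hilbert spaces\<close>

text \<open>
  The arguments \<open>x\<^sub>2, \<dots>, x\<^sub>n\<close> of an \<open>n\<close>-inner product are passed as a list of length \<open>n - 1\<close>;
  its values on lists of other lengths are irrelevant.
\<close>

definition lin_indep_list ::
  "('k::field \<Rightarrow> 'x::ab_group_add \<Rightarrow> 'x) \<Rightarrow> 'x list \<Rightarrow> bool"
  where "lin_indep_list scaleX xs \<longleftrightarrow> distinct xs \<and> \<not> module.dependent scaleX (set xs)"

definition n_norm :: "('x \<Rightarrow> 'x \<Rightarrow> 'x list \<Rightarrow> 'k::real_or_complex) \<Rightarrow> 'x \<Rightarrow> 'x list \<Rightarrow> real"
  where "n_norm nip x xs = sqrt (scalar_Re (nip x x xs))"

locale n_inner_product_space = vector_space scaleX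
  for scaleX :: "'k::real_or_complex \<Rightarrow> 'x::ab_group_add \<Rightarrow> 'x" +
  fixes n :: nat and nip :: "'x \<Rightarrow> 'x \<Rightarrow> 'x list \<Rightarrow> 'k"
  assumes n_ge_2: "n \<ge> 2"
    and dim_ge_n: "\<exists>bs. length bs = n \<and> lin_indep_list scaleX bs"
    and nip_self_nonneg: "length xs = n - 1 \<Longrightarrow> nip x x xs \<in> \<real>\<^sub>\<ge>\<^sub>0"
    and nip_self_eq_0: "length xs = n - 1 \<Longrightarrow>
      nip x x xs = 0 \<longleftrightarrow> \<not> lin_indep_list scaleX (x # xs)"
    and nip_permute: "length xs = n - 1 \<Longrightarrow> mset ys = mset xs \<Longrightarrow> nip x y ys = nip x y xs"
    and nip_commute: "length xs = n - 1 \<Longrightarrow> nip x y xs = scalar_cnj (nip y x xs)"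
    and nip_scale_left: "length xs = n - 1 \<Longrightarrow> nip (scaleX c x) y xs = c * nip x y xs"
    and nip_add_left: "length xs = n - 1 \<Longrightarrow> nip (x + x') y xs = nip x y xs + nip x' y xs"

definition n_converges_to ::
  "nat \<Rightarrow> ('x::ab_group_add \<Rightarrow> 'x \<Rightarrow> 'x list \<Rightarrow> 'k::real_or_complex) \<Rightarrow> (nat \<Rightarrow> 'x) \<Rightarrow> 'x \<Rightarrow> bool"
  where "n_converges_to n nip s x \<longleftrightarrow>
    (\<forall>xs. length xs = n - 1 \<longrightarrow> (\<lambda>k. n_norm nip (s k - x) xs) \<longlonglongrightarrow> 0)"

definition n_Cauchy ::
  "nat \<Rightarrow> ('x::ab_group_add \<Rightarrow> 'x \<Rightarrow> 'x list \<Rightarrow> 'k::real_or_complex) \<Rightarrow> (nat \<Rightarrow> 'x) \<Rightarrow> bool"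
  where "n_Cauchy n nip s \<longleftrightarrow>
    (\<forall>xs. length xs = n - 1 \<longrightarrow>
      ((\<lambda>(l, k). n_norm nip (s l - s k) xs) \<longlongrightarrow> 0) (sequentially \<times>\<^sub>F sequentially))"

locale n_hilbert_space = n_inner_product_space +
  assumes n_complete: "n_Cauchy n nip s \<Longrightarrow> \<exists>x. n_converges_to n nip s x"


section \<open>The Hilbert space associated with a list of vectors\<close>

text \<open>The coset \<open>x + L\<^sub>F\<close>, where \<open>F\<close> consists of the entries of \<open>a\<close>.\<close>

definition F_coset ::
  "('k::field \<Rightarrow> 'x::ab_group_add \<Rightarrow> 'x) \<Rightarrow> 'x list \<Rightarrow> 'x \<Rightarrow> 'x set"
  where "F_coset scaleX a x = (\<lambda>v. x + v) ` module.span scaleX (set a)"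

text \<open>
  The space \<open>X\<^sub>F\<close> is determined up to isometric isomorphism as a completion of the quotient
  \<open>X/L\<^sub>F\<close> with the inner product \<open>\<langle>x + L\<^sub>F, y + L\<^sub>F\<rangle>\<^sub>F = \<langle>x, y | a\<^sub>2, \<dots>, a\<^sub>n\<rangle>\<close>, that is, a Hilbert space
  with a linear isometric embedding \<open>j\<close> of \<open>X/L\<^sub>F\<close> onto a dense subspace. The values of \<open>j\<close> on
  sets that are not cosets are irrelevant.
\<close>

definition is_F_completion ::
  "('k::real_or_complex \<Rightarrow> 'x::ab_group_add \<Rightarrow> 'x) \<Rightarrow> ('x \<Rightarrow> 'x \<Rightarrow> 'x list \<Rightarrow> 'k) \<Rightarrow> 'x list \<Rightarrow>
   ('k \<Rightarrow> 'h::ab_group_add \<Rightarrow> 'h) \<Rightarrow> ('h \<Rightarrow> 'h \<Rightarrow> 'k) \<Rightarrow> ('x set \<Rightarrow> 'h) \<Rightarrow> bool"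
  where "is_F_completion scaleX nip a scaleF innF j \<longleftrightarrow>
    hilbert_space scaleF innF \<and>
    (\<forall>x y. j (F_coset scaleX a (x + y)) = j (F_coset scaleX a x) + j (F_coset scaleX a y)) \<and>
    (\<forall>c x. j (F_coset scaleX a (scaleX c x)) = scaleF c (j (F_coset scaleX a x))) \<and>
    (\<forall>x y. innF (j (F_coset scaleX a x)) (j (F_coset scaleX a y)) = nip x y a) \<and>
    hdense innF (range (\<lambda>x. j (F_coset scaleX a x)))"

text \<open>
  A sequence in \<open>X\<close> is a \<open>K\<close>-frame if its image \<open>i \<mapsto> j (f\<^sub>i + L\<^sub>F)\<close> in \<open>X\<^sub>F\<close> is one. The
  upper bound includes the finiteness of the sum, hence the summability condition.
\<close>

definition K_frame ::
  "('h \<Rightarrow> 'h \<Rightarrow> 'k::real_or_complex) \<Rightarrow> ('h \<Rightarrow> 'h) \<Rightarrow> (nat \<Rightarrow> 'h) \<Rightarrow> bool"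
  where "K_frame innF K f \<longleftrightarrow>
    (\<exists>A B. 0 < A \<and> A \<le> B \<and>
      (\<forall>h. summable (\<lambda>i. (norm (innF h (f i)))\<^sup>2) \<and>
        A * (hnorm innF (hadjoint innF K h))\<^sup>2 \<le> (\<Sum>i. (norm (innF h (f i)))\<^sup>2) \<and>
        (\<Sum>i. (norm (innF h (f i)))\<^sup>2) \<le> B * (hnorm innF h)\<^sup>2))"

end

theory Submission imports Defs begin

text \<open>
  The theorem is the case \<open>H = X\<^sub>F\<close>, \<open>G = \<ell>\<^sup>2\<close> of a statement about a sequence \<open>g\<close> and a bounded
  operator \<open>K\<close> in a Hilbert space \<open>H\<close>, and a Hilbert space \<open>G\<close> with an orthonormal basis \<open>e\<close>.
  If \<open>T e\<^sub>i = g\<^sub>i\<close> with \<open>T : G \<rightarrow> H\<close> linear and bounded, then Parseval's identity gives \<open>\<Sum>i. |\<langle>h, g\<^sub>i\<rangle>|\<^sup>2 = \<parallel>T\<^sup>* h\<parallel>\<^sup>2\<close>. The upper frame bound is thus the boundedness of \<open>T\<^sup>*\<close>,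
  and the lower one reads \<open>A \<parallel>K\<^sup>* h\<parallel>\<^sup>2 \<le> \<parallel>T\<^sup>* h\<parallel>\<^sup>2\<close>, which by Douglas' majorization theorem is
  equivalent to \<open>range K \<subseteq> range T\<close>.

  The analytic input is one representation theorem, \<open>Riesz_along_linear_map\<close>: a linear functional
  \<open>\<phi>\<close> with \<open>|\<phi> v| \<le> C \<parallel>S v\<parallel>\<close> has the form \<open>\<phi> v = \<langle>S v, u\<rangle>\<close>. For \<open>S = id\<close> it is the Riesz
  theorem and yields adjoints. For a frame, let \<open>S h\<close> be the \<open>\<ell>\<^sup>2\<close> sequence of the \<open>\<langle>h, g\<^sub>i\<rangle>\<close>; then
  \<open>T = S\<^sup>* \<circ> \<alpha>\<close> is the required operator, where \<open>\<alpha> : G \<rightarrow> \<ell>\<^sup>2\<close> takes coordinates with respect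
  to \<open>e\<close>. The lower frame bound says that \<open>h \<mapsto> \<langle>h, K x\<rangle> = \<langle>K\<^sup>* h, x\<rangle>\<close> is bounded by a multiple of
  \<open>\<parallel>S h\<parallel>\<close>, so that \<open>\<langle>h, K x\<rangle> = \<langle>S h, w\<rangle>\<close> for some \<open>w\<close>, that is, \<open>K x = S\<^sup>* w\<close>; and \<open>\<alpha>\<close> is onto.

  For the converse, \<open>K x = T c\<close> gives \<open>|\<langle>K\<^sup>* h, x\<rangle>| = |\<langle>T\<^sup>* h, c\<rangle>| \<le> \<parallel>c\<parallel>\<close> whenever \<open>\<parallel>T\<^sup>* h\<parallel> \<le> 1\<close>.
  So the set of these \<open>K\<^sup>* h\<close> is weakly bounded, hence bounded by the uniform boundedness principle
  (\<open>weakly_bounded_imp_bounded\<close>), and this is the lower frame bound up to scaling.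
\<close>

section \<open>Scalars\<close>

lemma to_complex_1: "to_complex (1 :: 'k::real_or_complex) = 1"
proof -
  have "to_complex (1 :: 'k) * to_complex (1 :: 'k) = to_complex (1 :: 'k)"
    by (metis to_complex_mult mult_1)
  moreover have "to_complex (1 :: 'k) \<noteq> 0"
    using norm_to_complex[of "1 :: 'k"] by auto
  ultimately show ?thesis
    by simp
qed

lemma to_complex_of_real: "to_complex (of_real r :: 'k::real_or_complex) = of_real r"
  unfolding of_real_def to_complex_scaleR to_complex_1 ..

lemma bounded_linear_to_complex: "bounded_linear (to_complex :: 'k::real_or_complex \<Rightarrow> complex)"
  by (rule bounded_linear_intro[where K = 1])
    (simp_all add: to_complex_add to_complex_scaleR norm_to_complex)

lemma to_complex_diff: "to_complex (x - y) = to_complex x - to_complex (y :: 'k::real_or_complex)"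
  by (rule linear_diff[OF bounded_linear.linear[OF bounded_linear_to_complex]])

lemmas to_complex_Cauchy = bounded_linear.Cauchy[OF bounded_linear_to_complex]

text \<open>Both possible images of the scalars in the complex numbers are closed.\<close>

instance real_or_complex \<subseteq> banach
proof
  fix X :: "nat \<Rightarrow> 'a"
  assume "Cauchy X"
  then have "Cauchy (\<lambda>i. to_complex (X i))"
    by (rule to_complex_Cauchy)
  then obtain L where L: "(\<lambda>i. to_complex (X i)) \<longlonglongrightarrow> L"
    by (auto simp: Cauchy_convergent_iff convergent_def)
  have "closed (range (to_complex :: 'a \<Rightarrow> complex))"
    using range_to_complex[where 'a = 'a] closed_complex_Reals by auto
  then have "L \<in> range (to_complex :: 'a \<Rightarrow> complex)"
    by (rule Lim_in_closed_set[OF _ _ _ L]) simp_all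
  then obtain l :: 'a where "L = to_complex l"
    by blast
  with L have "(\<lambda>i. norm (to_complex (X i - l))) \<longlonglongrightarrow> 0"
    by (simp add: LIM_zero_iff tendsto_norm_zero to_complex_diff)
  then have "X \<longlonglongrightarrow> l"
    by (simp add: norm_to_complex LIM_zero_iff tendsto_norm_zero_iff)
  then show "convergent X"
    by (rule convergentI)
qed

lemma scalar_cnj_cnj [simp]: "scalar_cnj (scalar_cnj x) = x"
  by (rule to_complex_eq_iff[THEN iffD1]) (simp add: to_complex_scalar_cnj)

lemma norm_scalar_cnj [simp]: "norm (scalar_cnj x) = norm x"
  using norm_to_complex[of x] norm_to_complex[of "scalar_cnj x"]
  by (simp add: to_complex_scalar_cnj)

lemma scalar_cnj_add: "scalar_cnj (x + y) = scalar_cnj x + scalar_cnj y"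
  by (rule to_complex_eq_iff[THEN iffD1]) (simp add: to_complex_scalar_cnj to_complex_add)

lemma scalar_cnj_diff: "scalar_cnj (x - y) = scalar_cnj x - scalar_cnj y"
  by (rule to_complex_eq_iff[THEN iffD1]) (simp add: to_complex_scalar_cnj to_complex_diff)

lemma scalar_cnj_mult: "scalar_cnj (x * y) = scalar_cnj x * scalar_cnj y"
  by (rule to_complex_eq_iff[THEN iffD1]) (simp add: to_complex_scalar_cnj to_complex_mult)

lemma scalar_cnj_of_real [simp]: "scalar_cnj (of_real r) = of_real r"
  by (rule to_complex_eq_iff[THEN iffD1]) (simp add: to_complex_scalar_cnj to_complex_of_real)

lemma scalar_cnj_mult_self: "x * scalar_cnj x = of_real ((norm x)\<^sup>2)"
proof -
  have "to_complex (x * scalar_cnj x) = of_real ((norm (to_complex x))\<^sup>2)"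
    by (simp only: to_complex_mult to_complex_scalar_cnj complex_norm_square)
  then have "to_complex (x * scalar_cnj x) = to_complex (of_real ((norm x)\<^sup>2) :: 'a)"
    by (simp only: norm_to_complex to_complex_of_real)
  then show ?thesis
    by (rule to_complex_eq_iff[THEN iffD1])
qed

lemma scalar_cnj_0 [simp]: "scalar_cnj 0 = (0 :: 'k::real_or_complex)"
  by (rule scalar_cnj_of_real[of 0, unfolded of_real_0])

lemma scalar_cnj_1 [simp]: "scalar_cnj 1 = (1 :: 'k::real_or_complex)"
  by (rule scalar_cnj_of_real[of 1, unfolded of_real_1])

lemma bounded_linear_scalar_Re: "bounded_linear (scalar_Re :: 'k::real_or_complex \<Rightarrow> real)"
  unfolding scalar_Re_def
  by (rule bounded_linear_compose[OF bounded_linear_Re bounded_linear_to_complex])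

lemma scalar_Re_add: "scalar_Re (x + y) = scalar_Re x + scalar_Re y"
  and scalar_Re_diff: "scalar_Re (x - y) = scalar_Re x - scalar_Re y"
  and scalar_Re_minus: "scalar_Re (- x) = - scalar_Re x"
  by (simp_all add: bounded_linear.linear[OF bounded_linear_scalar_Re] linear_add linear_diff linear_neg)

lemma bounded_linear_scalar_cnj: "bounded_linear (scalar_cnj :: 'k::real_or_complex \<Rightarrow> 'k)"
proof (rule bounded_linear_intro[where K = 1])
  show "scalar_cnj (r *\<^sub>R x) = r *\<^sub>R scalar_cnj x" for r and x :: 'k
    by (simp add: scaleR_conv_of_real scalar_cnj_mult)
qed (simp_all add: scalar_cnj_add)

lemmas scalar_cnj_suminf = bounded_linear.suminf[OF bounded_linear_scalar_cnj]

lemma scalar_Re_of_real [simp]: "scalar_Re (of_real r :: 'k::real_or_complex) = r"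
  by (simp add: scalar_Re_def to_complex_of_real)

lemma scalar_Re_cnj [simp]: "scalar_Re (scalar_cnj x) = scalar_Re x"
  by (simp add: scalar_Re_def to_complex_scalar_cnj)

lemma scalar_Re_mult_of_real: "scalar_Re (of_real r * x) = r * scalar_Re x"
  by (simp add: scalar_Re_def to_complex_mult to_complex_of_real)

lemma scalar_Re_le_norm: "\<bar>scalar_Re x\<bar> \<le> norm x"
  unfolding scalar_Re_def using abs_Re_le_cmod[of "to_complex x"] by (simp add: norm_to_complex)

section \<open>Geometry of Hilbert spaces\<close>

lemma linear_into_scalars_iff:
  fixes scaleV :: "'k::field \<Rightarrow> 'v::ab_group_add \<Rightarrow> 'v"
  assumes "vector_space scaleV"
  shows "Vector_Spaces.linear scaleV (*) \<phi> \<longleftrightarrow>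
    (\<forall>v w. \<phi> (v + w) = \<phi> v + \<phi> w) \<and> (\<forall>c v. \<phi> (scaleV c v) = c * \<phi> v)"
  using assms vector_space_over_itself.vector_space_axioms[where 'a = 'k]
  by (simp add: Vector_Spaces.linear_iff)

context hilbert_space
begin

lemma inn_self: "inn x x = of_real ((hnorm inn x)\<^sup>2)"
proof -
  obtain r where "inn x x = of_real r" "r \<ge> 0"
    using inn_self_nonneg[of x] by (auto elim: nonneg_Reals_cases)
  then show ?thesis
    by (simp add: hnorm_def)
qed

lemma hnorm_nonneg [simp]: "0 \<le> hnorm inn x"
proof -
  obtain r where "inn x x = of_real r" "r \<ge> 0"
    using inn_self_nonneg[of x] by (auto elim: nonneg_Reals_cases)
  then show ?thesis
    by (simp add: hnorm_def)
qed

lemma hnorm_square: "(hnorm inn x)\<^sup>2 = scalar_Re (inn x x)"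
  by (simp add: inn_self del: of_real_power)

lemma hnorm_eq_0 [simp]: "hnorm inn x = 0 \<longleftrightarrow> x = 0"
  using inn_self_eq_0[of x] by (simp add: inn_self)

lemma hnorm_0 [simp]: "hnorm inn 0 = 0"
  by simp

lemma inn_add_right: "inn x (y + z) = inn x y + inn x z"
  by (simp only: inn_commute[of x] inn_add_left scalar_cnj_add)

lemma inn_scale_right: "inn x (scaleH c y) = scalar_cnj c * inn x y"
  by (simp only: inn_commute[of x] inn_scale_left scalar_cnj_mult)

sublocale inn_left: additive "\<lambda>x. inn x y" for y
  by standard (rule inn_add_left)

sublocale inn_right: additive "inn x" for x
  by standard (rule inn_add_right)

lemma norm_inn_commute: "norm (inn x y) = norm (inn y x)"
  by (simp only: inn_commute[of x y] norm_scalar_cnj)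

lemma hnorm_square_add:
  "(hnorm inn (x + y))\<^sup>2 = (hnorm inn x)\<^sup>2 + 2 * scalar_Re (inn x y) + (hnorm inn y)\<^sup>2"
proof -
  have "scalar_Re (inn y x) = scalar_Re (inn x y)"
    by (simp only: inn_commute[of y x] scalar_Re_cnj)
  then show ?thesis
    by (simp add: hnorm_square inn_add_left inn_add_right scalar_Re_add)
qed

lemma hnorm_square_diff:
  "(hnorm inn (x - y))\<^sup>2 = (hnorm inn x)\<^sup>2 - 2 * scalar_Re (inn x y) + (hnorm inn y)\<^sup>2"
  using hnorm_square_add[of x "- y"]
  by (simp add: hnorm_square inn_left.minus inn_right.minus scalar_Re_minus)

lemma hnorm_scale: "hnorm inn (scaleH c x) = norm c * hnorm inn x"
proof -
  have "inn (scaleH c x) (scaleH c x) = (c * scalar_cnj c) * inn x x"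
    by (simp add: inn_scale_left inn_scale_right)
  then have "(hnorm inn (scaleH c x))\<^sup>2 = (norm c * hnorm inn x)\<^sup>2"
    by (simp only: inn_self scalar_cnj_mult_self of_real_mult[symmetric] of_real_eq_iff
        power_mult_distrib)
  then show ?thesis
    by (simp add: power2_eq_iff_nonneg)
qed

lemma hnorm_minus [simp]: "hnorm inn (- x) = hnorm inn x"
  using hnorm_scale[of "-1" x] by simp

lemma hnorm_minus_commute: "hnorm inn (x - y) = hnorm inn (y - x)"
  using hnorm_minus[of "x - y"] by simp

text \<open>The vector \<open>x - c y\<close> below is the component of \<open>x\<close> orthogonal to \<open>y\<close>.\<close>

lemma Cauchy_Schwarz: "norm (inn x y) \<le> hnorm inn x * hnorm inn y"
proof (cases "y = 0")
  case True
  then show ?thesis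
    by (simp add: inn_right.zero)
next
  case False
  define s where "s = (hnorm inn y)\<^sup>2"
  define c where "c = of_real (1 / s) * inn x y"
  have s: "s > 0"
    using False by (simp add: s_def less_le)
  have "scalar_Re (inn x (scaleH c y)) = scalar_Re (of_real (1 / s) * (inn x y * scalar_cnj (inn x y)))"
    by (simp only: inn_scale_right c_def scalar_cnj_mult scalar_cnj_of_real mult_ac)
  also have "\<dots> = (norm (inn x y))\<^sup>2 / s"
    by (simp only: scalar_Re_mult_of_real scalar_cnj_mult_self scalar_Re_of_real) simp
  finally have 1: "scalar_Re (inn x (scaleH c y)) = (norm (inn x y))\<^sup>2 / s" .
  have 2: "(hnorm inn (scaleH c y))\<^sup>2 = (norm (inn x y))\<^sup>2 / s"
    using s by (simp add: hnorm_scale c_def norm_mult power_mult_distrib norm_divide power_divide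
        s_def[symmetric]) (simp add: power2_eq_square)
  have "0 \<le> (hnorm inn (x - scaleH c y))\<^sup>2"
    by simp
  also have "\<dots> = (hnorm inn x)\<^sup>2 - (norm (inn x y))\<^sup>2 / s"
    by (simp add: hnorm_square_diff 1 2)
  finally have "(norm (inn x y))\<^sup>2 \<le> (hnorm inn x)\<^sup>2 * s"
    using s by (simp add: field_simps)
  then show ?thesis
    by (intro power2_le_imp_le[of "norm (inn x y)"]) (simp_all add: s_def power_mult_distrib)
qed

lemma hnorm_triangle: "hnorm inn (x + y) \<le> hnorm inn x + hnorm inn y"
proof (rule power2_le_imp_le)
  have "scalar_Re (inn x y) \<le> hnorm inn x * hnorm inn y"
    using scalar_Re_le_norm[of "inn x y"] Cauchy_Schwarz[of x y] by linarith
  then show "(hnorm inn (x + y))\<^sup>2 \<le> (hnorm inn x + hnorm inn y)\<^sup>2"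
    by (simp add: hnorm_square_add power2_sum)
qed simp

lemma inn_right_eqI:
  assumes "\<And>h. inn h x = inn h y"
  shows "x = y"
  using assms[of "x - y"] inn_self_eq_0[of "x - y"] by (simp add: inn_right.diff)

lemma inn_tendsto_right:
  assumes "(\<lambda>k. hnorm inn (s k - u)) \<longlonglongrightarrow> 0"
  shows "(\<lambda>k. inn x (s k)) \<longlonglongrightarrow> inn x u"
proof (rule Lim_transform2[OF tendsto_const], rule Lim_null_comparison)
  show "(\<lambda>k. hnorm inn x * hnorm inn (s k - u)) \<longlonglongrightarrow> 0"
    using tendsto_mult_left[OF assms, of "hnorm inn x"] by simp
  show "\<forall>\<^sub>F k in sequentially. norm (inn x u - inn x (s k)) \<le> hnorm inn x * hnorm inn (s k - u)"
    using Cauchy_Schwarz[of x "u - s _"] by (simp add: inn_right.diff hnorm_minus_commute[of u])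
qed

lemma Cauchy_converges:
  assumes "\<And>\<epsilon>. \<epsilon> > 0 \<Longrightarrow> \<exists>N. \<forall>l\<ge>N. \<forall>k\<ge>N. hnorm inn (s l - s k) < \<epsilon>"
  shows "\<exists>x. (\<lambda>k. hnorm inn (s k - x)) \<longlonglongrightarrow> 0"
proof (rule complete, rule tendstoI)
  fix \<epsilon> :: real
  assume "\<epsilon> > 0"
  then show "\<forall>\<^sub>F p in sequentially \<times>\<^sub>F sequentially.
      dist (case p of (l, k) \<Rightarrow> hnorm inn (s l - s k)) 0 < \<epsilon>"
    using assms[of \<epsilon>] by (simp add: eventually_prod_sequentially) blast
qed

text \<open>
  The functional \<open>J v = \<parallel>S v\<parallel>\<^sup>2 - 2 Re (\<phi> v)\<close> is bounded below by \<open>- C\<^sup>2\<close>. The images under \<open>S\<close> of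
  a minimizing sequence form a Cauchy sequence, although the sequence itself need not converge in any
  sense; their limit \<open>u\<close>, a point of the closure of the range of \<open>S\<close>, satisfies the Euler equation
  \<open>\<phi> v = \<langle>S v, u\<rangle>\<close>.
\<close>

lemma Riesz_along_linear_map:
  assumes S: "Vector_Spaces.linear scaleV scaleH S"
    and \<phi>: "Vector_Spaces.linear scaleV (*) \<phi>"
    and bound: "\<And>v. norm (\<phi> v) \<le> C * hnorm inn (S v)"
  shows "\<exists>u. \<forall>v. \<phi> v = inn (S v) u"
proof -
  interpret S: Vector_Spaces.linear scaleV scaleH S by (rule S)
  interpret \<phi>: Vector_Spaces.linear scaleV "(*)" \<phi> by (rule \<phi>)
  define J where "J v = (hnorm inn (S v))\<^sup>2 - 2 * scalar_Re (\<phi> v)" for v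
  have J_bound: "J v \<ge> - C\<^sup>2" for v
  proof -
    have "scalar_Re (\<phi> v) \<le> C * hnorm inn (S v)"
      using scalar_Re_le_norm[of "\<phi> v"] bound[of v] by linarith
    then show ?thesis
      unfolding J_def using sum_squares_bound[of C "hnorm inn (S v)"] by linarith
  qed
  then have bdd: "bdd_below (range J)"
    by (intro bdd_belowI[of _ "- C\<^sup>2"]) auto
  define m where "m = Inf (range J)"
  have m: "m \<le> J v" for v
    unfolding m_def by (rule cInf_lower[OF _ bdd]) simp
  have "\<exists>v. J v < m + inverse (Suc k)" for k
    using cInf_lessD[of "range J" "m + inverse (Suc k)"] unfolding m_def by auto
  then obtain v where v: "J (v k) < m + inverse (Suc k)" for k
    by metis
  \<comment> \<open>The parallelogram law, with the midpoint \<open>w\<close> compared to the infimum.\<close>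
  have Cauchy: "(hnorm inn (S (v l) - S (v k)))\<^sup>2 \<le> 2 * inverse (Suc l) + 2 * inverse (Suc k)" for l k
  proof -
    define w where "w = scaleV (1 / 2) (v l + v k)"
    have "\<phi> (v l + v k) = \<phi> (scaleV (of_real 2) w)"
      by (simp add: w_def)
    then have "scalar_Re (\<phi> (v l) + \<phi> (v k)) = scalar_Re (of_real 2 * \<phi> w)"
      by (simp only: \<phi>.scale \<phi>.add)
    then have "2 * scalar_Re (\<phi> w) = scalar_Re (\<phi> (v l)) + scalar_Re (\<phi> (v k))"
      by (simp only: scalar_Re_mult_of_real scalar_Re_add)
    moreover have "S (v l) + S (v k) = scaleH 2 (S w)"
      by (simp add: w_def S.scale S.add)
    then have "(hnorm inn (S (v l) + S (v k)))\<^sup>2 = 4 * (hnorm inn (S w))\<^sup>2"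
      by (simp add: hnorm_scale power_mult_distrib)
    ultimately have "(hnorm inn (S (v l) - S (v k)))\<^sup>2 = 2 * J (v l) + 2 * J (v k) - 4 * J w"
      unfolding J_def hnorm_square_diff hnorm_square_add by simp
    then show ?thesis
      using m[of w] v[of l] v[of k] by linarith
  qed
  have "\<exists>u. (\<lambda>k. hnorm inn (S (v k) - u)) \<longlonglongrightarrow> 0"
  proof (rule Cauchy_converges)
    fix \<epsilon> :: real
    assume "\<epsilon> > 0"
    then obtain N where N: "inverse (real (Suc N)) < \<epsilon>\<^sup>2 / 4"
      using reals_Archimedean[of "\<epsilon>\<^sup>2 / 4"] by auto
    have "hnorm inn (S (v l) - S (v k)) < \<epsilon>" if "l \<ge> N" "k \<ge> N" for l k
    proof (rule power2_less_imp_less)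
      have "inverse (real (Suc l)) \<le> inverse (Suc N)" "inverse (real (Suc k)) \<le> inverse (Suc N)"
        using that by (auto intro!: le_imp_inverse_le)
      then show "(hnorm inn (S (v l) - S (v k)))\<^sup>2 < \<epsilon>\<^sup>2"
        using Cauchy[of l k] N by linarith
    qed (use \<open>\<epsilon> > 0\<close> in simp)
    then show "\<exists>N. \<forall>l\<ge>N. \<forall>k\<ge>N. hnorm inn (S (v l) - S (v k)) < \<epsilon>"
      by blast
  qed
  then obtain u where u: "(\<lambda>k. hnorm inn (S (v k) - u)) \<longlonglongrightarrow> 0"
    by blast
  \<comment> \<open>Minimality of the limit along the line \<open>v k + t w\<close>.\<close>
  have Re_eq: "scalar_Re (\<phi> w) = scalar_Re (inn (S w) u)" for w
  proof -
    define d where "d = scalar_Re (inn (S w) u) - scalar_Re (\<phi> w)"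
    have pos: "0 \<le> t\<^sup>2 * (hnorm inn (S w))\<^sup>2 + 2 * t * d" for t :: real
    proof -
      define r where "r k = t\<^sup>2 * (hnorm inn (S w))\<^sup>2
        + 2 * t * (scalar_Re (inn (S w) (S (v k))) - scalar_Re (\<phi> w)) + inverse (real (Suc k))" for k
      have "0 \<le> r k" for k
      proof -
        have "J (scaleV (of_real t) w + v k) = t\<^sup>2 * (hnorm inn (S w))\<^sup>2
          + 2 * t * (scalar_Re (inn (S w) (S (v k))) - scalar_Re (\<phi> w)) + J (v k)"
          unfolding J_def S.add S.scale \<phi>.add \<phi>.scale hnorm_square_add hnorm_scale
            inn_scale_left scalar_Re_mult_of_real scalar_Re_add power_mult_distrib
          by (simp add: algebra_simps)
        then show ?thesis
          unfolding r_def using m[of "scaleV (of_real t) w + v k"] v[of k] by linarith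
      qed
      moreover have "r \<longlonglongrightarrow> t\<^sup>2 * (hnorm inn (S w))\<^sup>2 + 2 * t * d + 0"
        unfolding r_def d_def
        by (intro tendsto_intros bounded_linear.tendsto[OF bounded_linear_scalar_Re] inn_tendsto_right u LIMSEQ_inverse_real_of_nat)
      ultimately show ?thesis
        using LIMSEQ_le_const[of r] by fastforce
    qed
    \<comment> \<open>A quadratic in \<open>t\<close> without constant term stays nonnegative only if its linear term vanishes.\<close>
    have "d = 0"
    proof (rule ccontr)
      assume "d \<noteq> 0"
      define q where "q = (hnorm inn (S w))\<^sup>2 + 1"
      have q: "q > 0"
        by (simp add: q_def add_nonneg_pos)
      have "0 \<le> (d / q)\<^sup>2 * (q - 1) + 2 * (- d / q) * d"
        using pos[of "- d / q"] by (simp add: q_def)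
      also have "\<dots> = - (d / q)\<^sup>2 * (q + 1)"
        using q by (simp add: field_simps power2_eq_square)
      also have "\<dots> < 0"
        using q \<open>d \<noteq> 0\<close> by (simp add: mult_neg_pos)
      finally show False
        by simp
    qed
    then show ?thesis
      by (simp add: d_def)
  qed
  \<comment> \<open>The real parts at the vector \<open>cnj z w\<close> give the equality of the scalars.\<close>
  have "\<phi> w = inn (S w) u" for w
  proof -
    define z where "z = \<phi> w - inn (S w) u"
    have "scalar_Re (z * scalar_cnj z) = 0"
      using Re_eq[of "scaleV (scalar_cnj z) w"]
      by (simp add: z_def S.scale \<phi>.scale inn_scale_left scalar_Re_diff algebra_simps)
    then show ?thesis
      by (simp add: scalar_cnj_mult_self z_def del: of_real_power)
  qed
  then show ?thesis
    by blast
qed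

lemma Riesz_representation:
  assumes "Vector_Spaces.linear scaleH (*) \<phi>" and "\<And>v. norm (\<phi> v) \<le> C * hnorm inn v"
  shows "\<exists>u. \<forall>v. \<phi> v = inn v u"
  using Riesz_along_linear_map[OF linear_id assms(1), of C] assms(2) by simp

text \<open>
  The uniform boundedness principle, by a gliding hump. If \<open>\<parallel>v\<^sub>n\<parallel> > 4\<^sup>n\<close>, start at \<open>0\<close> and take steps
  of length \<open>(1/3)\<^sup>n\<close> along \<open>\<plusminus> v\<^sub>n\<close>. For one of the two signs the pairing with \<open>v\<^sub>n\<close> has at least
  the size \<open>(1/3)\<^sup>n \<parallel>v\<^sub>n\<parallel>\<close>, since the two values differ by twice that. All later steps together
  can undo at most half of this, so at the limit point the pairing with \<open>v\<^sub>n\<close> exceeds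
  \<open>(4/3)\<^sup>n / 2\<close> for every \<open>n\<close>.
\<close>

lemma weakly_bounded_imp_bounded:
  assumes "\<And>x. \<exists>C. \<forall>v\<in>V. norm (inn v x) \<le> C"
  shows "\<exists>M. \<forall>v\<in>V. hnorm inn v \<le> M"
proof (rule ccontr)
  assume "\<not> ?thesis"
  then have "\<exists>v\<in>V. hnorm inn v > 4 ^ n" for n :: nat
    by (meson not_less)
  then obtain v where vV: "v n \<in> V" and v: "hnorm inn (v n) > 4 ^ n" for n :: nat
    by metis
  have v0: "hnorm inn (v n) > 0" for n
    using v[of n] by (rule less_trans[rotated]) simp
  define c where "c n = (1 / 3) ^ n / hnorm inn (v n)" for n
  have c: "c n * hnorm inn (v n) = (1 / 3) ^ n" and c0: "c n > 0" for n
    using less_imp_neq[OF v0[of n], symmetric] v0[of n] by (simp_all add: c_def)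
  define next_pt where "next_pt n x =
    (if norm (inn (v n) (x + scaleH (of_real (c n)) (v n))) \<ge> (1 / 3) ^ n * hnorm inn (v n)
     then x + scaleH (of_real (c n)) (v n) else x - scaleH (of_real (c n)) (v n))" for n x
  define x where "x = rec_nat 0 next_pt"
  have x_Suc: "x (Suc n) = next_pt n (x n)" for n
    by (simp add: x_def)
  have far: "norm (inn (v n) (x (Suc n))) \<ge> (1 / 3) ^ n * hnorm inn (v n)" for n
  proof -
    define b where "b = inn (v n) (scaleH (of_real (c n)) (v n))"
    have "norm b = c n * (hnorm inn (v n))\<^sup>2"
      using c0[of n] by (simp add: b_def inn_scale_right inn_self norm_mult norm_power)
    also have "\<dots> = (1 / 3) ^ n * hnorm inn (v n)"
      by (simp add: c[symmetric] power2_eq_square)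
    finally have b: "norm b = (1 / 3) ^ n * hnorm inn (v n)" .
    have "2 * norm b = norm ((inn (v n) (x n) + b) - (inn (v n) (x n) - b))"
      by (simp flip: mult_2 add: norm_mult)
    also have "\<dots> \<le> norm (inn (v n) (x n) + b) + norm (inn (v n) (x n) - b)"
      by (rule norm_triangle_ineq4)
    finally show ?thesis
      using b by (auto simp: x_Suc next_pt_def inn_right.add inn_right.diff b_def)
  qed
  have step: "hnorm inn (x (Suc n) - x n) = (1 / 3) ^ n" for n
    using c0[of n] by (simp add: x_Suc next_pt_def hnorm_scale c hnorm_minus_commute[of "x n - _"])
  have dist: "hnorm inn (x (n + k) - x n) \<le> (3 / 2) * (1 / 3) ^ n * (1 - (1 / 3) ^ k)" for n k
  proof (induction k)
    case 0
    then show ?case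
      by simp
  next
    case (Suc k)
    have "hnorm inn (x (n + Suc k) - x n)
        \<le> hnorm inn (x (Suc (n + k)) - x (n + k)) + hnorm inn (x (n + k) - x n)"
      using hnorm_triangle[of "x (Suc (n + k)) - x (n + k)" "x (n + k) - x n"] by simp
    also have "\<dots> \<le> (1 / 3) ^ (n + k) + (3 / 2) * (1 / 3) ^ n * (1 - (1 / 3) ^ k)"
      using Suc.IH by (simp add: step)
    also have "\<dots> = (3 / 2) * (1 / 3) ^ n * (1 - (1 / 3) ^ Suc k)"
      by (simp add: power_add field_simps)
    finally show ?case .
  qed
  have dist': "hnorm inn (x m - x n) \<le> (3 / 2) * (1 / 3) ^ n" if "m \<ge> n" for m n
  proof -
    have "(3 / 2) * (1 / 3) ^ n * (1 - (1 / 3) ^ (m - n)) \<le> (3 / 2) * (1 / 3 :: real) ^ n * 1"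
      by (rule mult_left_mono) simp_all
    with dist[of n "m - n"] show ?thesis
      using that by (simp only: le_add_diff_inverse mult_1_right order_trans)
  qed
  have "\<exists>y. (\<lambda>k. hnorm inn (x k - y)) \<longlonglongrightarrow> 0"
  proof (rule Cauchy_converges)
    fix \<epsilon> :: real
    assume "\<epsilon> > 0"
    then obtain N where N: "(1 / 3) ^ N < \<epsilon> / 3"
      using real_arch_pow_inv[of "\<epsilon> / 3" "1 / 3"] by auto
    have "hnorm inn (x l - x k) < \<epsilon>" if "l \<ge> N" "k \<ge> N" for l k
      using hnorm_triangle[of "x l - x N" "x N - x k"] dist'[OF that(1)] dist'[OF that(2)] N
      by (simp add: hnorm_minus_commute[of "x N"])
    then show "\<exists>N. \<forall>l\<ge>N. \<forall>k\<ge>N. hnorm inn (x l - x k) < \<epsilon>"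
      by blast
  qed
  then obtain y where y: "(\<lambda>k. hnorm inn (x k - y)) \<longlonglongrightarrow> 0"
    by blast
  \<comment> \<open>The limit stays within half of the \<open>n\<close>-th step of \<open>x (Suc n)\<close>, since \<open>1/3 + 1/9 + \<dots> = 1/2\<close>.\<close>
  have close: "hnorm inn (y - x (Suc n)) \<le> (1 / 2) * (1 / 3) ^ n" for n
  proof (rule field_le_epsilon)
    fix \<epsilon> :: real
    assume "\<epsilon> > 0"
    then have "\<forall>\<^sub>F k in sequentially. hnorm inn (x k - y) < \<epsilon>"
      using order_tendstoD(2)[OF y] by blast
    then obtain k where k: "k \<ge> Suc n" "hnorm inn (x k - y) < \<epsilon>"
      unfolding eventually_sequentially by (meson linorder_le_cases order_refl)
    have "hnorm inn (y - x (Suc n)) \<le> hnorm inn (y - x k) + hnorm inn (x k - x (Suc n))"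
      using hnorm_triangle[of "y - x k" "x k - x (Suc n)"] by simp
    then show "hnorm inn (y - x (Suc n)) \<le> (1 / 2) * (1 / 3) ^ n + \<epsilon>"
      using k dist'[OF k(1)] by (simp add: hnorm_minus_commute[of y])
  qed
  obtain C where C: "norm (inn w y) \<le> C" if "w \<in> V" for w
    using assms[of y] by blast
  have "(4 / 3) ^ n \<le> 2 * C" for n
  proof -
    have "norm (inn (v n) (y - x (Suc n))) \<le> hnorm inn (v n) * ((1 / 2) * (1 / 3) ^ n)"
      by (rule order_trans[OF Cauchy_Schwarz mult_left_mono[OF close]]) simp
    then have "norm (inn (v n) y) \<ge> (1 / 3) ^ n * hnorm inn (v n) / 2"
      using far[of n] norm_triangle_ineq2[of "inn (v n) (x (Suc n))" "inn (v n) y"]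
      by (simp add: inn_right.diff norm_minus_commute mult.commute)
    moreover have "(1 / 3) ^ n * hnorm inn (v n) \<ge> (1 / 3) ^ n * 4 ^ n"
      using v[of n] by (intro mult_left_mono) simp_all
    moreover have "(1 / 3) ^ n * 4 ^ n = (4 / 3 :: real) ^ n"
      by (simp add: power_mult_distrib[symmetric])
    ultimately show ?thesis
      using C[OF vV[of n]] by linarith
  qed
  moreover obtain n where "(4 / 3) ^ n > 2 * C"
    using real_arch_pow[of "4 / 3" "2 * C"] by auto
  ultimately show False
    by (meson not_less)
qed

end

lemma exists_adjoint:
  assumes G: "hilbert_space scaleG innG" and H: "hilbert_space scaleH innH"
    and T: "bounded_operator scaleG innG scaleH innH T"
  obtains T' where "bounded_operator scaleH innH scaleG innG T'"
    and "\<And>c h. innH (T c) h = innG c (T' h)"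
proof -
  interpret G: hilbert_space scaleG innG by (rule G)
  interpret H: hilbert_space scaleH innH by (rule H)
  from T obtain C where lin: "Vector_Spaces.linear scaleG scaleH T"
    and C: "\<And>x. hnorm innH (T x) \<le> C * hnorm innG x"
    unfolding bounded_operator_def by blast
  interpret T: Vector_Spaces.linear scaleG scaleH T by (rule lin)
  have "\<exists>u. \<forall>c. innH (T c) h = innG c u" for h
  proof (rule G.Riesz_representation)
    show "Vector_Spaces.linear scaleG (*) (\<lambda>c. innH (T c) h)"
      by (simp add: linear_into_scalars_iff[OF G.vector_space_axioms] T.add T.scale
          H.inn_add_left H.inn_scale_left)
    show "norm (innH (T c) h) \<le> (C * hnorm innH h) * hnorm innG c" for c
      using order_trans[OF H.Cauchy_Schwarz mult_right_mono[OF C H.hnorm_nonneg]]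
      by (simp add: mult_ac)
  qed
  then obtain T' where T': "innH (T c) h = innG c (T' h)" for c h
    by metis
  have "Vector_Spaces.linear scaleH scaleG T'"
    unfolding Vector_Spaces.linear_iff
  proof (intro conjI allI)
    show "T' (x + y) = T' x + T' y" for x y
      by (rule G.inn_right_eqI) (simp add: G.inn_add_right H.inn_add_right flip: T')
    show "T' (scaleH c x) = scaleG c (T' x)" for c x
      by (rule G.inn_right_eqI) (simp add: G.inn_scale_right H.inn_scale_right flip: T')
  qed (rule G.vector_space_axioms H.vector_space_axioms)+
  moreover have "hnorm innG (T' h) \<le> \<bar>C\<bar> * hnorm innH h" for h
  proof (cases "T' h = 0")
    case False
    have "hnorm innG (T' h) * hnorm innG (T' h) = norm (innH (T (T' h)) h)"
      by (simp only: T' G.inn_self norm_of_real) (simp add: power2_eq_square)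
    also have "\<dots> \<le> (C * hnorm innG (T' h)) * hnorm innH h"
      by (rule order_trans[OF H.Cauchy_Schwarz mult_right_mono[OF C H.hnorm_nonneg]])
    also have "\<dots> \<le> (\<bar>C\<bar> * hnorm innG (T' h)) * hnorm innH h"
      by (intro mult_right_mono) simp_all
    finally have "hnorm innG (T' h) * hnorm innG (T' h) \<le> hnorm innG (T' h) * (\<bar>C\<bar> * hnorm innH h)"
      by (simp add: mult_ac)
    then show ?thesis
      using False by (simp add: mult_le_cancel_left less_le)
  qed simp
  ultimately show thesis
    using T' by (intro that[of T']) (auto simp: bounded_operator_def)
qed

section \<open>The Hilbert space of square-summable sequences\<close>

lemma l2_summable: "summable (\<lambda>i. (norm (l2_nth x i))\<^sup>2)"
  using l2_nth[of x] by simp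

lemma l2_inn_summable:
  fixes x y :: "'k::real_or_complex l2"
  shows "summable (\<lambda>i. l2_nth x i * scalar_cnj (l2_nth y i))"
proof (rule summable_comparison_test')
  show "summable (\<lambda>i. (norm (l2_nth x i))\<^sup>2 + (norm (l2_nth y i))\<^sup>2)"
    by (intro summable_add l2_summable)
  show "norm (l2_nth x i * scalar_cnj (l2_nth y i)) \<le> (norm (l2_nth x i))\<^sup>2 + (norm (l2_nth y i))\<^sup>2"
    if "i \<ge> 0" for i
  proof -
    have "0 \<le> norm (l2_nth x i) * norm (l2_nth y i)"
      by simp
    then show ?thesis
      using sum_squares_bound[of "norm (l2_nth x i)" "norm (l2_nth y i)"]
      unfolding norm_mult norm_scalar_cnj by linarith
  qed
qed

lemma l2_inn_self: "l2_inn x x = of_real (\<Sum>i. (norm (l2_nth x i))\<^sup>2)"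
  unfolding l2_inn_def scalar_cnj_mult_self
  by (rule bounded_linear.suminf[OF bounded_linear_of_real l2_summable, symmetric])

lemma hnorm_l2_square: "(hnorm l2_inn x)\<^sup>2 = (\<Sum>i. (norm (l2_nth x i))\<^sup>2)"
  by (simp add: hnorm_def l2_inn_self suminf_nonneg l2_summable del: of_real_power)

lemma norm_l2_nth_le: "norm (l2_nth x i) \<le> hnorm l2_inn x"
proof (rule power2_le_imp_le)
  show "(norm (l2_nth x i))\<^sup>2 \<le> (hnorm l2_inn x)\<^sup>2"
    unfolding hnorm_l2_square
    using sum_le_suminf[OF l2_summable, of "{i}" x] by simp
  show "0 \<le> hnorm l2_inn x"
    by (simp add: hnorm_def l2_inn_self suminf_nonneg l2_summable del: of_real_power)
qed

text \<open>
  The limit is taken coordinatewise. Distances to it are estimated on finitely many coordinates, where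
  the limit may be exchanged with the sum, with a bound that does not depend on their number.
\<close>

lemma l2_complete:
  fixes s :: "nat \<Rightarrow> 'k::real_or_complex l2"
  assumes "((\<lambda>(l, k). hnorm l2_inn (s l - s k)) \<longlongrightarrow> 0) (sequentially \<times>\<^sub>F sequentially)"
  shows "\<exists>x. (\<lambda>k. hnorm l2_inn (s k - x)) \<longlonglongrightarrow> 0"
proof -
  have Cauchy: "\<exists>N. \<forall>l\<ge>N. \<forall>k\<ge>N. hnorm l2_inn (s l - s k) < \<epsilon>" if \<epsilon>: "\<epsilon> > 0" for \<epsilon>
  proof -
    obtain N where "\<forall>l\<ge>N. \<forall>k\<ge>N. dist (hnorm l2_inn (s l - s k)) 0 < \<epsilon>"
      using tendstoD[OF assms \<epsilon>] by (auto simp: eventually_prod_sequentially)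
    then show ?thesis
      by (simp only: dist_0_norm dist_commute[of _ 0] real_norm_def) (meson abs_ge_self le_less_trans)
  qed
  have "convergent (\<lambda>k. l2_nth (s k) i)" for i
  proof -
    have "Cauchy (\<lambda>k. l2_nth (s k) i)"
    proof (rule CauchyI)
      fix \<epsilon> :: real
      assume "\<epsilon> > 0"
      then obtain N where N: "\<forall>l\<ge>N. \<forall>k\<ge>N. hnorm l2_inn (s l - s k) < \<epsilon>"
        using Cauchy by blast
      have "norm (l2_nth (s l) i - l2_nth (s k) i) < \<epsilon>" if "l \<ge> N" "k \<ge> N" for l k
        using norm_l2_nth_le[of "s l - s k" i] N that
        by (auto simp: minus_l2.rep_eq intro: le_less_trans)
      then show "\<exists>N. \<forall>l\<ge>N. \<forall>k\<ge>N. norm (l2_nth (s l) i - l2_nth (s k) i) < \<epsilon>"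
        by blast
    qed
    then show ?thesis
      by (rule Cauchy_convergent)
  qed
  then obtain y where y: "(\<lambda>k. l2_nth (s k) i) \<longlonglongrightarrow> y i" for i
    unfolding convergent_def by metis
  have partial: "(\<Sum>i<M. (norm (l2_nth (s l) i - y i))\<^sup>2) \<le> \<epsilon>\<^sup>2"
    if \<epsilon>: "\<epsilon> > 0" and N: "\<forall>l\<ge>N. \<forall>k\<ge>N. hnorm l2_inn (s l - s k) < \<epsilon>" and l: "l \<ge> N" for l M N \<epsilon>
  proof (rule LIMSEQ_le_const2)
    show "(\<lambda>k. \<Sum>i<M. (norm (l2_nth (s l) i - l2_nth (s k) i))\<^sup>2)
        \<longlonglongrightarrow> (\<Sum>i<M. (norm (l2_nth (s l) i - y i))\<^sup>2)"
      by (intro tendsto_intros y)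
    have "(\<Sum>i<M. (norm (l2_nth (s l) i - l2_nth (s k) i))\<^sup>2) \<le> \<epsilon>\<^sup>2" if "k \<ge> N" for k
    proof -
      have "(\<Sum>i<M. (norm (l2_nth (s l) i - l2_nth (s k) i))\<^sup>2) \<le> (hnorm l2_inn (s l - s k))\<^sup>2"
        unfolding hnorm_l2_square
        using sum_le_suminf[OF l2_summable, of "{..<M}" "s l - s k"] by (simp add: minus_l2.rep_eq)
      also have "\<dots> \<le> \<epsilon>\<^sup>2"
        using N l that order_trans[OF norm_ge_zero norm_l2_nth_le]
        by (intro power_mono) (auto intro: less_imp_le)
      finally show ?thesis .
    qed
    then show "\<exists>N. \<forall>k\<ge>N. (\<Sum>i<M. (norm (l2_nth (s l) i - l2_nth (s k) i))\<^sup>2) \<le> \<epsilon>\<^sup>2"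
      by blast
  qed
  have tail: "summable (\<lambda>i. (norm (l2_nth (s l) i - y i))\<^sup>2)
      \<and> (\<Sum>i. (norm (l2_nth (s l) i - y i))\<^sup>2) \<le> \<epsilon>\<^sup>2"
    if "\<epsilon> > 0" "\<forall>l\<ge>N. \<forall>k\<ge>N. hnorm l2_inn (s l - s k) < \<epsilon>" "l \<ge> N" for l N \<epsilon>
  proof
    show "summable (\<lambda>i. (norm (l2_nth (s l) i - y i))\<^sup>2)"
      by (rule summableI_nonneg_bounded[OF _ partial[OF that]]) simp
    then show "(\<Sum>i. (norm (l2_nth (s l) i - y i))\<^sup>2) \<le> \<epsilon>\<^sup>2"
      by (rule suminf_le_const[OF _ partial[OF that]])
  qed
  obtain N where N: "\<forall>l\<ge>N. \<forall>k\<ge>N. hnorm l2_inn (s l - s k) < 1"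
    using Cauchy[of 1] by auto
  have "summable (\<lambda>i. (norm (l2_nth (s N) i - y i))\<^sup>2)"
    using tail[OF _ N] by simp
  then have "summable (\<lambda>i. (norm (y i - l2_nth (s N) i))\<^sup>2)"
    by (simp add: norm_minus_commute)
  from summable_norm_square_add[OF this l2_summable[of "s N"]]
  have y_nth: "l2_nth (Abs_l2 y) = y"
    by (intro Abs_l2_inverse) simp
  show ?thesis
  proof (rule exI, rule LIMSEQ_I)
    fix \<epsilon> :: real
    assume "\<epsilon> > 0"
    then have half: "\<epsilon> / 2 > 0"
      by simp
    then obtain N where N: "\<forall>l\<ge>N. \<forall>k\<ge>N. hnorm l2_inn (s l - s k) < \<epsilon> / 2"
      using Cauchy by blast
    have "norm (hnorm l2_inn (s l - Abs_l2 y) - 0) < \<epsilon>" if "l \<ge> N" for l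
    proof -
      have "(hnorm l2_inn (s l - Abs_l2 y))\<^sup>2 \<le> (\<epsilon> / 2)\<^sup>2"
        unfolding hnorm_l2_square using tail[OF half N that] by (simp add: minus_l2.rep_eq y_nth)
      then have "hnorm l2_inn (s l - Abs_l2 y) \<le> \<epsilon> / 2"
        by (rule power2_le_imp_le) (use half in simp)
      moreover have "0 \<le> hnorm l2_inn (s l - Abs_l2 y)"
        by (rule order_trans[OF norm_ge_zero norm_l2_nth_le])
      ultimately show ?thesis
        using \<open>\<epsilon> > 0\<close> by simp
    qed
    then show "\<exists>N. \<forall>l\<ge>N. norm (hnorm l2_inn (s l - Abs_l2 y) - 0) < \<epsilon>"
      by blast
  qed
qed

lemma hilbert_space_l2:
  "hilbert_space (l2_scale :: 'k::real_or_complex \<Rightarrow> 'k l2 \<Rightarrow> 'k l2) l2_inn"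
proof unfold_locales
  show "l2_scale a (x + y) = l2_scale a x + l2_scale a y"
    "l2_scale (a + b) x = l2_scale a x + l2_scale b x"
    "l2_scale a (l2_scale b x) = l2_scale (a * b) x"
    "l2_scale 1 x = x" for a b :: 'k and x y
    by (transfer; simp add: algebra_simps)+
  show "l2_inn x x \<in> \<real>\<^sub>\<ge>\<^sub>0" for x :: "'k l2"
    unfolding l2_inn_self by (simp add: suminf_nonneg l2_summable nonneg_Reals_of_real_iff)
  show "l2_inn x x = 0 \<longleftrightarrow> x = 0" for x :: "'k l2"
  proof
    assume "l2_inn x x = 0"
    then have "hnorm l2_inn x = 0"
      by (simp add: hnorm_def scalar_Re_def to_complex_of_real[of 0, simplified])
    then show "x = 0"
      using norm_l2_nth_le[of x] by (simp add: l2_nth_inject[symmetric] zero_l2.rep_eq fun_eq_iff)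
  qed (simp add: l2_inn_def zero_l2.rep_eq)
  show "l2_inn x y = scalar_cnj (l2_inn y x)" for x y :: "'k l2"
    unfolding l2_inn_def scalar_cnj_suminf[OF l2_inn_summable]
    by (simp add: scalar_cnj_mult mult.commute)
  show "l2_inn (x + x') y = l2_inn x y + l2_inn x' y" for x x' y :: "'k l2"
    unfolding l2_inn_def suminf_add[OF l2_inn_summable l2_inn_summable]
    by (simp add: plus_l2.rep_eq distrib_right)
  show "l2_inn (l2_scale c x) y = c * l2_inn x y" for c :: 'k and x y
    unfolding l2_inn_def suminf_mult[OF l2_inn_summable, symmetric]
    by (simp add: l2_scale.rep_eq mult.assoc)
qed (rule l2_complete)

interpretation l2: hilbert_space l2_scale l2_inn
  by (rule hilbert_space_l2)

section \<open>Expansion in an orthonormal basis\<close>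

lemma norm_square_diff_scalar:
  fixes x y :: "'k::real_or_complex"
  shows "(norm (x - y))\<^sup>2 = (norm x)\<^sup>2 - 2 * scalar_Re (scalar_cnj y * x) + (norm y)\<^sup>2"
proof -
  have sq: "(norm z)\<^sup>2 = scalar_Re (z * scalar_cnj z)" for z :: 'k
    by (simp only: scalar_cnj_mult_self scalar_Re_of_real)
  have "scalar_Re (x * scalar_cnj y) = scalar_Re (y * scalar_cnj x)"
    using scalar_Re_cnj[of "x * scalar_cnj y"] by (simp only: scalar_cnj_mult scalar_cnj_cnj mult.commute)
  then show ?thesis
    unfolding sq scalar_cnj_diff left_diff_distrib right_diff_distrib scalar_Re_diff
    by (simp add: mult.commute)
qed

context hilbert_space
begin

text \<open>
  With \<open>c\<^sub>i = \<langle>x, e\<^sub>i\<rangle>\<close> this gives Bessel's inequality; for arbitrary \<open>c\<close> it says that no other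
  combination is closer to \<open>x\<close>, which turns density of the span into Parseval's identity.
\<close>

lemma hnorm_square_diff_orthonormal_sum:
  fixes e :: "nat \<Rightarrow> 'h"
  assumes e: "\<And>i j. inn (e i) (e j) = (if i = j then 1 else 0)"
  shows "(hnorm inn (x - (\<Sum>i<N. scaleH (c i) (e i))))\<^sup>2
    = (hnorm inn x)\<^sup>2 - (\<Sum>i<N. (norm (inn x (e i)))\<^sup>2) + (\<Sum>i<N. (norm (inn x (e i) - c i))\<^sup>2)"
proof (induction N)
  case 0
  then show ?case
    by simp
next
  case (Suc N)
  define r where "r = x - (\<Sum>i<N. scaleH (c i) (e i))"
  have "inn (\<Sum>i<N. scaleH (c i) (e i)) (e N) = 0"
    by (simp add: inn_left.sum inn_scale_left e)
  then have r: "inn r (e N) = inn x (e N)"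
    by (simp add: r_def inn_left.diff)
  have "hnorm inn (e N) = 1"
    by (simp add: hnorm_def e scalar_Re_of_real[of 1, simplified])
  then have "(hnorm inn (r - scaleH (c N) (e N)))\<^sup>2
      = (hnorm inn r)\<^sup>2 - (norm (inn x (e N)))\<^sup>2 + (norm (inn x (e N) - c N))\<^sup>2"
    by (simp add: hnorm_square_diff hnorm_scale inn_scale_right r norm_square_diff_scalar)
  then show ?case
    using Suc.IH by (simp add: r_def algebra_simps)
qed

lemma span_range_nat_obtains:
  assumes "y \<in> span (range (e :: nat \<Rightarrow> _))"
  obtains N c where "y = (\<Sum>i<N. scaleH (c i) (e i))"
proof -
  \<comment> \<open>Allowing every larger length lets two combinations be added without padding.\<close>
  have "\<exists>N. \<forall>M\<ge>N. \<exists>c. y = (\<Sum>i<M. scaleH (c i) (e i))"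
    using assms
  proof (induction rule: span_induct_alt)
    case base
    show ?case
      by (auto intro!: exI[of _ 0] exI[of _ "\<lambda>_. 0"])
  next
    case (step a x y)
    then obtain j N where j: "x = e j" and N: "\<forall>M\<ge>N. \<exists>c. y = (\<Sum>i<M. scaleH (c i) (e i))"
      by blast
    have "\<exists>c. scaleH a x + y = (\<Sum>i<M. scaleH (c i) (e i))" if "M \<ge> max N (Suc j)" for M
    proof -
      from N that obtain c where "y = (\<Sum>i<M. scaleH (c i) (e i))"
        by auto
      then have "scaleH a x + y = (\<Sum>i<M. scaleH ((if i = j then a else 0) + c i) (e i))"
        using that by (simp add: j scale_left_distrib sum.distrib if_distrib[of "\<lambda>a. scaleH a _"]
            cong: if_cong)
      then show ?thesis
        by (rule exI[where x = "\<lambda>i. (if i = j then a else 0) + c i"])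
    qed
    then show ?case
      by blast
  qed
  then show thesis
    using that by blast
qed

lemma Parseval:
  assumes "orthonormal_basis scaleH inn e"
  shows "(\<lambda>i. (norm (inn x (e i)))\<^sup>2) sums (hnorm inn x)\<^sup>2"
proof -
  have e: "inn (e i) (e j) = (if i = j then 1 else 0)" for i j
    using assms by (simp add: orthonormal_basis_def)
  let ?a = "\<lambda>i. (norm (inn x (e i)))\<^sup>2"
  have bessel: "(\<Sum>i<N. ?a i) \<le> (hnorm inn x)\<^sup>2" for N
    using hnorm_square_diff_orthonormal_sum[OF e, where x = x and c = "\<lambda>i. inn x (e i)" and N = N]
      zero_le_power2[of "hnorm inn (x - (\<Sum>i<N. scaleH (inn x (e i)) (e i)))"]
    by simp
  have summable: "summable ?a"
    by (rule summableI_nonneg_bounded[OF _ bessel]) simp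
  have "(hnorm inn x)\<^sup>2 \<le> suminf ?a"
  proof (rule field_le_epsilon)
    fix \<epsilon> :: real
    assume \<epsilon>: "\<epsilon> > 0"
    then obtain y where "y \<in> span (range e)" and y: "hnorm inn (x - y) < sqrt \<epsilon>"
      using assms real_sqrt_gt_zero[OF \<epsilon>] unfolding orthonormal_basis_def hdense_def by blast
    then obtain N c where "y = (\<Sum>i<N. scaleH (c i) (e i))"
      using span_range_nat_obtains by blast
    then have "(hnorm inn (x - y))\<^sup>2
        = (hnorm inn x)\<^sup>2 - (\<Sum>i<N. ?a i) + (\<Sum>i<N. (norm (inn x (e i) - c i))\<^sup>2)"
      using hnorm_square_diff_orthonormal_sum[OF e] by simp
    moreover have "0 \<le> (\<Sum>i<N. (norm (inn x (e i) - c i))\<^sup>2)"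
      by (intro sum_nonneg) simp
    moreover have "(\<Sum>i<N. ?a i) \<le> suminf ?a"
      by (rule sum_le_suminf[OF summable]) simp_all
    moreover have "(hnorm inn (x - y))\<^sup>2 \<le> \<epsilon>"
      using power_mono[OF less_imp_le[OF y] hnorm_nonneg, of 2] \<epsilon> by simp
    ultimately show "(hnorm inn x)\<^sup>2 \<le> suminf ?a + \<epsilon>"
      by linarith
  qed
  then have "suminf ?a = (hnorm inn x)\<^sup>2"
    using suminf_le_const[OF summable bessel] by simp
  then show ?thesis
    using summable by (metis summable_sums)
qed

text \<open>
  The analysis operator of a sequence \<open>g\<close> in frame theory; it takes values in \<open>\<ell>\<^sup>2\<close> only
  where the squares are summable.
\<close>

definition coeffs :: "(nat \<Rightarrow> 'h) \<Rightarrow> 'h \<Rightarrow> 'k l2"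
  where "coeffs g h = Abs_l2 (\<lambda>i. inn h (g i))"

lemma l2_nth_coeffs:
  assumes "summable (\<lambda>i. (norm (inn h (g i)))\<^sup>2)"
  shows "l2_nth (coeffs g h) i = inn h (g i)"
  using assms by (simp add: coeffs_def Abs_l2_inverse)

lemma bounded_operator_coeffs:
  assumes sum: "\<And>h. summable (\<lambda>i. (norm (inn h (g i)))\<^sup>2)"
    and bound: "\<And>h. (\<Sum>i. (norm (inn h (g i)))\<^sup>2) \<le> B * (hnorm inn h)\<^sup>2"
  shows "bounded_operator scaleH inn l2_scale l2_inn (coeffs g)"
  unfolding bounded_operator_def
proof (intro conjI exI allI)
  show "Vector_Spaces.linear scaleH l2_scale (coeffs g)"
    by (simp add: Vector_Spaces.linear_iff vector_space_axioms l2.vector_space_axioms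
        l2_nth_inject[symmetric] fun_eq_iff plus_l2.rep_eq l2_scale.rep_eq l2_nth_coeffs[OF sum]
        inn_add_left inn_scale_left)
  show "hnorm l2_inn (coeffs g h) \<le> sqrt \<bar>B\<bar> * hnorm inn h" for h
  proof (rule power2_le_imp_le)
    have "(hnorm l2_inn (coeffs g h))\<^sup>2 \<le> \<bar>B\<bar> * (hnorm inn h)\<^sup>2"
      unfolding hnorm_l2_square l2_nth_coeffs[OF sum]
      using bound[of h] by (rule order_trans) (simp add: mult_right_mono)
    then show "(hnorm l2_inn (coeffs g h))\<^sup>2 \<le> (sqrt \<bar>B\<bar> * hnorm inn h)\<^sup>2"
      by (simp add: power_mult_distrib)
  qed simp
qed

text \<open>
  Surjectivity is the Riesz--Fischer theorem. A preimage of \<open>w\<close> is \<open>\<alpha>\<^sup>* w\<close>, where \<open>\<alpha>\<close> is the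
  coordinate map: since \<open>\<alpha> e\<^sub>i\<close> is the \<open>i\<close>-th unit sequence, \<open>\<langle>\<alpha>\<^sup>* w, e\<^sub>i\<rangle> = \<langle>w, \<alpha> e\<^sub>i\<rangle> = w\<^sub>i\<close>. No
  series in the Hilbert space has to be summed.
\<close>

lemma coeffs_basis:
  assumes "orthonormal_basis scaleH inn e"
  shows bounded_operator_coeffs_basis: "bounded_operator scaleH inn l2_scale l2_inn (coeffs e)"
    and l2_inn_coeffs_basis: "l2_inn w (coeffs e (e i)) = l2_nth w i"
    and surj_coeffs_basis: "surj (coeffs e)"
proof -
  have e: "inn (e i) (e j) = (if i = j then 1 else 0)" for i j
    using assms by (simp add: orthonormal_basis_def)
  note sums = Parseval[OF assms]
  note nth = l2_nth_coeffs[OF sums_summable[OF sums]]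
  show bdd: "bounded_operator scaleH inn l2_scale l2_inn (coeffs e)"
    by (rule bounded_operator_coeffs[where B = 1])
      (simp_all add: sums_summable[OF sums] sums_unique[OF sums, symmetric])
  show unit: "l2_inn w (coeffs e (e i)) = l2_nth w i" for w i
  proof -
    have "(\<lambda>k. l2_nth w k * scalar_cnj (l2_nth (coeffs e (e i)) k)) = (\<lambda>k. if k = i then l2_nth w k else 0)"
      by (auto simp: nth e)
    then show ?thesis
      unfolding l2_inn_def using sums_single[of i "l2_nth w"] by (simp add: sums_iff)
  qed
  obtain R where R: "l2_inn (coeffs e c) w = inn c (R w)" for c w
    using exists_adjoint[OF hilbert_space_axioms hilbert_space_l2 bdd] by blast
  have "coeffs e (R w) = w" for w
  proof -
    have "inn (R w) (e i) = l2_nth w i" for i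
      by (simp only: inn_commute[of "R w" "e i"] R[symmetric]
          l2.inn_commute[of w "coeffs e (e i)", symmetric] unit)
    then show ?thesis
      by (simp add: l2_nth_inject[symmetric] fun_eq_iff nth)
  qed
  then show "surj (coeffs e)"
    by (rule surjI)
qed

end

section \<open>Frames and operators\<close>

lemma bounded_operator_comp:
  assumes H: "hilbert_space scaleH innH"
    and S: "bounded_operator scaleG innG scaleH innH S"
    and T: "bounded_operator scaleH innH scaleL innL T"
  shows "bounded_operator scaleG innG scaleL innL (T \<circ> S)"
proof -
  interpret H: hilbert_space scaleH innH by (rule H)
  obtain C D where C: "\<And>x. hnorm innH (S x) \<le> C * hnorm innG x"
    and D: "\<And>x. hnorm innL (T x) \<le> D * hnorm innH x"
    using S T unfolding bounded_operator_def by blast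
  have "hnorm innL ((T \<circ> S) x) \<le> (\<bar>D\<bar> * C) * hnorm innG x" for x
  proof -
    have "hnorm innL (T (S x)) \<le> \<bar>D\<bar> * hnorm innH (S x)"
      by (rule order_trans[OF D]) (simp add: mult_right_mono)
    also have "\<dots> \<le> \<bar>D\<bar> * (C * hnorm innG x)"
      by (intro mult_left_mono C) simp
    finally show ?thesis
      by (simp add: mult.assoc)
  qed
  then show ?thesis
    using S T Vector_Spaces.linear_compose unfolding bounded_operator_def by blast
qed

lemma hadjoint_eqI:
  assumes "hilbert_space scaleH inn" and "\<And>h f. inn (K h) f = inn h (K' f)"
  shows "hadjoint inn K = K'"
proof
  interpret hilbert_space scaleH inn by (rule assms(1))
  show "hadjoint inn K f = K' f" for f
    unfolding hadjoint_def
    by (rule the_equality) (auto simp: assms(2) intro: inn_right_eqI)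
qed

lemma hadjoint:
  assumes "hilbert_space scaleH inn" and "bounded_operator scaleH inn scaleH inn K"
  shows "inn (K h) f = inn h (hadjoint inn K f)"
    and "Vector_Spaces.linear scaleH scaleH (hadjoint inn K)"
proof -
  obtain K' where K': "bounded_operator scaleH inn scaleH inn K'"
    "\<And>h f. inn (K h) f = inn h (K' f)"
    using exists_adjoint[OF assms(1,1,2)] by blast
  moreover from K'(2) have "hadjoint inn K = K'"
    by (rule hadjoint_eqI[OF assms(1)])
  ultimately show "inn (K h) f = inn h (hadjoint inn K f)"
    "Vector_Spaces.linear scaleH scaleH (hadjoint inn K)"
    by (simp_all add: bounded_operator_def)
qed

text \<open>
  With the analysis operator \<open>S\<close> of \<open>g\<close>, the upper frame bound is the boundedness of \<open>S\<close> and the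
  lower one is \<open>\<surd>A \<parallel>K\<^sup>* h\<parallel> \<le> \<parallel>S h\<parallel>\<close>, the hypothesis for representing \<open>h \<mapsto> \<langle>h, K x\<rangle>\<close> along \<open>S\<close>.
\<close>

lemma K_frame_imp_operator:
  assumes G: "hilbert_space scaleG innG" and H: "hilbert_space scaleH innH"
    and K: "bounded_operator scaleH innH scaleH innH K"
    and e: "orthonormal_basis scaleG innG e"
    and frame: "K_frame innH K g"
  shows "\<exists>T. bounded_operator scaleG innG scaleH innH T \<and> (\<forall>i. g i = T (e i)) \<and> range K \<subseteq> range T"
proof -
  interpret G: hilbert_space scaleG innG by (rule G)
  interpret H: hilbert_space scaleH innH by (rule H)
  let ?K' = "hadjoint innH K"
  obtain A B where A: "A > 0"
    and sum: "\<And>h. summable (\<lambda>i. (norm (innH h (g i)))\<^sup>2)"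
    and lower: "\<And>h. A * (hnorm innH (?K' h))\<^sup>2 \<le> (\<Sum>i. (norm (innH h (g i)))\<^sup>2)"
    and upper: "\<And>h. (\<Sum>i. (norm (innH h (g i)))\<^sup>2) \<le> B * (hnorm innH h)\<^sup>2"
    using frame unfolding K_frame_def by blast
  define S where "S = H.coeffs g"
  have S: "bounded_operator scaleH innH l2_scale l2_inn S"
    unfolding S_def by (rule H.bounded_operator_coeffs[OF sum upper])
  obtain S' where S': "bounded_operator l2_scale l2_inn scaleH innH S'"
    and adj: "\<And>h w. l2_inn (S h) w = innH h (S' w)"
    using exists_adjoint[OF H hilbert_space_l2 S] by blast
  define T where "T = S' \<circ> G.coeffs e"
  have "bounded_operator scaleG innG scaleH innH T"
    unfolding T_def by (rule bounded_operator_comp[OF hilbert_space_l2 G.bounded_operator_coeffs_basis[OF e] S'])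
  moreover have "g i = T (e i)" for i
    by (rule H.inn_right_eqI)
      (simp add: T_def adj[symmetric] G.l2_inn_coeffs_basis[OF e] S_def H.l2_nth_coeffs[OF sum])
  moreover have "K x \<in> range T" for x
  proof -
    have "\<exists>w. \<forall>h. innH h (K x) = l2_inn (S h) w"
    proof (rule l2.Riesz_along_linear_map)
      show "Vector_Spaces.linear scaleH l2_scale S"
        using S by (simp add: bounded_operator_def)
      show "Vector_Spaces.linear scaleH (*) (\<lambda>h. innH h (K x))"
        by (simp add: linear_into_scalars_iff[OF H.vector_space_axioms]
            H.inn_add_left H.inn_scale_left)
      show "norm (innH h (K x)) \<le> (hnorm innH x / sqrt A) * hnorm l2_inn (S h)" for h
      proof -
        have "(sqrt A * hnorm innH (?K' h))\<^sup>2 \<le> (hnorm l2_inn (S h))\<^sup>2"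
          unfolding hnorm_l2_square S_def H.l2_nth_coeffs[OF sum]
          using lower[of h] A by (simp add: power_mult_distrib)
        then have 1: "sqrt A * hnorm innH (?K' h) \<le> hnorm l2_inn (S h)"
          by (rule power2_le_imp_le) simp
        have "norm (innH h (K x)) = norm (innH x (?K' h))"
          by (simp only: H.norm_inn_commute[of h] hadjoint(1)[OF H K])
        also have "\<dots> \<le> hnorm innH x * hnorm innH (?K' h)"
          by (rule H.Cauchy_Schwarz)
        also have "\<dots> = (hnorm innH x / sqrt A) * (sqrt A * hnorm innH (?K' h))"
          using A by simp
        also have "\<dots> \<le> (hnorm innH x / sqrt A) * hnorm l2_inn (S h)"
          using A by (intro mult_left_mono 1) simp
        finally show ?thesis .
      qed
    qed
    then obtain w where w: "innH h (K x) = l2_inn (S h) w" for h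
      by blast
    obtain u where "w = G.coeffs e u"
      using G.surj_coeffs_basis[OF e] by (metis surjD)
    then have "K x = T u"
      by (intro H.inn_right_eqI) (simp add: w T_def adj)
    then show ?thesis
      by simp
  qed
  ultimately show ?thesis
    by blast
qed

text \<open>
  Nothing is known about the norm of a \<open>c\<close> with \<open>K x = T c\<close> in terms of \<open>x\<close>, so the lower bound
  cannot be read off directly; the uniform boundedness principle supplies it.
\<close>

lemma operator_imp_K_frame:
  assumes G: "hilbert_space scaleG innG" and H: "hilbert_space scaleH innH"
    and K: "bounded_operator scaleH innH scaleH innH K"
    and e: "orthonormal_basis scaleG innG e"
    and T: "bounded_operator scaleG innG scaleH innH T"
    and range: "range K \<subseteq> range T"
  shows "K_frame innH K (\<lambda>i. T (e i))"
proof -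
  interpret G: hilbert_space scaleG innG by (rule G)
  interpret H: hilbert_space scaleH innH by (rule H)
  let ?K' = "hadjoint innH K"
  interpret K': Vector_Spaces.linear scaleH scaleH ?K'
    by (rule hadjoint(2)[OF H K])
  obtain T' where T': "bounded_operator scaleH innH scaleG innG T'"
    and adj: "\<And>c h. innH (T c) h = innG c (T' h)"
    using exists_adjoint[OF G H T] by blast
  from T' interpret T': Vector_Spaces.linear scaleH scaleG T'
    by (simp add: bounded_operator_def)
  obtain C where C: "\<And>h. hnorm innG (T' h) \<le> C * hnorm innH h"
    using T' unfolding bounded_operator_def by blast
  have sums: "(\<lambda>i. (norm (innH h (T (e i))))\<^sup>2) sums (hnorm innG (T' h))\<^sup>2" for h
    using G.Parseval[OF e, of "T' h"]
    by (simp add: H.norm_inn_commute[of h] adj G.norm_inn_commute[of "T' h"])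
  have "\<exists>M. \<forall>v\<in>{?K' h | h. hnorm innG (T' h) \<le> 1}. hnorm innH v \<le> M"
  proof (rule H.weakly_bounded_imp_bounded)
    fix x
    obtain c where c: "K x = T c"
      using range by blast
    have "norm (innH (?K' h) x) \<le> hnorm innG c" if "hnorm innG (T' h) \<le> 1" for h
    proof -
      have "norm (innH (?K' h) x) = norm (innG c (T' h))"
        by (simp only: H.norm_inn_commute[of _ x] hadjoint(1)[OF H K, symmetric] c adj)
      also have "\<dots> \<le> hnorm innG c * hnorm innG (T' h)"
        by (rule G.Cauchy_Schwarz)
      also have "\<dots> \<le> hnorm innG c * 1"
        using that by (intro mult_left_mono) simp_all
      finally show ?thesis
        by simp
    qed
    then show "\<exists>D. \<forall>v\<in>{?K' h | h. hnorm innG (T' h) \<le> 1}. norm (innH v x) \<le> D"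
      by blast
  qed
  then obtain M where M: "hnorm innH (?K' h) \<le> M" if "hnorm innG (T' h) \<le> 1" for h
    by blast
  define L where "L = max M 1"
  have L: "L > 0"
    by (simp add: L_def)
  \<comment> \<open>Rescaling \<open>h\<close> by \<open>1 / \<delta>\<close> with \<open>\<delta> > \<parallel>T' h\<parallel>\<close> covers the case \<open>T' h = 0\<close> as well.\<close>
  have lower: "hnorm innH (?K' h) \<le> L * hnorm innG (T' h)" for h
  proof -
    have scaled: "hnorm innH (?K' h) \<le> L * \<delta>" if \<delta>: "\<delta> > hnorm innG (T' h)" for \<delta>
    proof -
      have pos: "\<delta> > 0"
        using \<delta> G.hnorm_nonneg le_less_trans by blast
      define h' where "h' = scaleH (of_real (1 / \<delta>)) h"
      have "hnorm innG (T' h') \<le> 1"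
        unfolding h'_def T'.scale G.hnorm_scale norm_of_real using pos \<delta> by simp
      then have "hnorm innH (?K' h') \<le> L"
        using M[of h'] by (simp add: L_def)
      then show ?thesis
        unfolding h'_def K'.scale H.hnorm_scale norm_of_real using pos by (simp add: field_simps)
    qed
    have "hnorm innH (?K' h) / L \<le> hnorm innG (T' h)"
      by (rule dense_ge) (use scaled L in \<open>simp add: field_simps\<close>)
    then show ?thesis
      using L by (simp add: field_simps)
  qed
  \<comment> \<open>Squaring \<open>lower\<close> gives \<open>A\<close>; adding it to \<open>C\<^sup>2\<close> ensures that the upper bound is at least \<open>A\<close>.\<close>
  define A where "A = 1 / L\<^sup>2"
  have A: "A > 0"
    using L by (simp add: A_def)
  have "A * (hnorm innH (?K' h))\<^sup>2 \<le> (hnorm innG (T' h))\<^sup>2" for h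
    using power_mono[OF lower[of h] H.hnorm_nonneg, of 2] L
    by (simp add: A_def power_mult_distrib field_simps)
  moreover have "(hnorm innG (T' h))\<^sup>2 \<le> (A + C\<^sup>2) * (hnorm innH h)\<^sup>2" for h
    using power_mono[OF C[of h] G.hnorm_nonneg, of 2] A
    by (simp add: power_mult_distrib distrib_right add_increasing)
  ultimately show ?thesis
    unfolding K_frame_def using A sums_summable[OF sums] sums_unique[OF sums, symmetric]
    by (intro exI[of _ A] exI[of _ "A + C\<^sup>2"]) simp
qed

theorem theorem3p6:
  fixes scaleX :: "'k::real_or_complex \<Rightarrow> 'x::ab_group_add \<Rightarrow> 'x"
    and n :: nat
    and nip :: "'x \<Rightarrow> 'x \<Rightarrow> 'x list \<Rightarrow> 'k"
    and a :: "'x list"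
    and scaleF :: "'k \<Rightarrow> 'h::ab_group_add \<Rightarrow> 'h"
    and innF :: "'h \<Rightarrow> 'h \<Rightarrow> 'k"
    and j :: "'x set \<Rightarrow> 'h"
    and K :: "'h \<Rightarrow> 'h"
    and e :: "nat \<Rightarrow> 'k l2"
    and f :: "nat \<Rightarrow> 'x"
  assumes "n_hilbert_space scaleX n nip"
    and "length a = n - 1" and "lin_indep_list scaleX a"
    and "is_F_completion scaleX nip a scaleF innF j"
    and "bounded_operator scaleF innF scaleF innF K"
    and "orthonormal_basis l2_scale l2_inn e"
  shows "K_frame innF K (\<lambda>i. j (F_coset scaleX a (f i))) \<longleftrightarrow>
    (\<exists>T. bounded_operator l2_scale l2_inn scaleF innF T \<and>
      (\<forall>i. j (F_coset scaleX a (f i)) = T (e i)) \<and>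
      range K \<subseteq> range T)"
proof -
  from assms(4) have H: "hilbert_space scaleF innF"
    by (simp add: is_F_completion_def)
  show ?thesis (is "?frame \<longleftrightarrow> ?operator")
  proof
    assume ?frame
    then show ?operator
      by (rule K_frame_imp_operator[OF hilbert_space_l2 H assms(5,6)])
  next
    assume ?operator
    then obtain T where T: "bounded_operator l2_scale l2_inn scaleF innF T"
      and f: "\<forall>i. j (F_coset scaleX a (f i)) = T (e i)" and range: "range K \<subseteq> range T"
      by blast
    show ?frame
      unfolding f[rule_format]
      by (rule operator_imp_K_frame[OF hilbert_space_l2 H assms(5,6) T range])
  qed
qed

end
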